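(* (Dual Cauchy identity.) In $\mathbb{A}\otimes_{\mathbb{Z}}\mathbb{A}$ one has $$\sum_\lambda U_\lambda\otimes V_\lambda=\sum_\lambda t_\lambda\otimes v_\lambda,$$ where the sums either run over all partitions $\lambda$ of a fixed (arbitrary) integer $n\ge 0$, or are regarded as formal sums over all partitions.
   Context: An integer sequence (integer vector) is a sequence $\alpha=(\alpha_1,\alpha_2,\ldots)$ of integers with only finitely many nonzero terms; it is a partition if $\alpha_i\ge\alpha_{i+1}\ge 0$ for all $i$, and a partition of $n$ if moreover $\sum_i\alpha_i=n$. Let $\mathbb{A}=\mathbb{Z}[u_1,u_2,\ldots]$ be the polynomial ring in countably many independent variables, with $u_0=1$ and $u_r=0$ for $r<0$. For an integer vector $\alpha$ put $u_\alpha=\prod_i u_{\alpha_i}$. For $i<j$ let $R_{ij}(\alpha)=(\alpha_1,\ldots,\alpha_i+1,\ldots,\alpha_j-1,\ldots)$; a raising operator $R$ is a monomial in the $R_{ij}$, and $R\,u_\alpha:=u_{R\alpha}$ (the operator acts on the index $\alpha$). The Schur polynomial of an integer vector $\alpha$ is $$U_\alpha:=\prod_{i<j}(1-R_{ij})\,u_\alpha\in\mathbb{A};$$ after formal expansion only finitely many summands are nonzero. The $U_\lambda$ for $\lambda$ a partition form a $\mathbb{Z}$-basis of $\mathbb{A}$. The Kostka numbers $K_{\lambda,\mu}$ ($\lambda,\mu$ partitions) are defined by $u_\mu=\sum_\lambda K_{\lambda,\mu}U_\lambda$; $K_{\lambda,\mu}$ is the number of semistandard Young tableaux of shape $\lambda$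 and content $\mu$. The matrix $K=\{K_{\lambda,\mu}\}$ is lower unitriangular with respect to dominance order, so the equations $U_\lambda=\sum_\mu K_{\lambda,\mu}\,t_\mu$ (sum over partitions $\mu$) define a $\mathbb{Z}$-basis $\{t_\lambda\}$ of $\mathbb{A}$ indexed by partitions. Let $v_r=U_{(1^r)}$ for $r\ge 1$ (where $(1^r)$ has $r$ parts equal to $1$), $v_0=1$, $v_r=0$ for $r<0$, and $v_\alpha=\prod_i v_{\alpha_i}$. Let $\omega:\mathbb{A}\to\mathbb{A}$ be the ring homomorphism with $\omega(u_r)=v_r$ for all $r$, and set $V_\lambda=\omega(U_\lambda)=\prod_{i<j}(1-R_{ij})\,v_\lambda$ for each partition $\lambda$. *)

theory Defs
  imports "HOL-Library.Poly_Mapping"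
begin

section \<open>Tensor product of abelian groups\<close>

text \<open>
  The usual construction: the free abelian group on the pairs, modulo the subgroup generated
  by the biadditivity relations.
\<close>

inductive_set biadd_rels :: "(('a::ab_group_add \<times> 'b::ab_group_add) \<Rightarrow>\<^sub>0 int) set" where
  zero: "0 \<in> biadd_rels"
| diff: "x \<in> biadd_rels \<Longrightarrow> y \<in> biadd_rels \<Longrightarrow> x - y \<in> biadd_rels"
| left: "frag_of (a + a', b) - frag_of (a, b) - frag_of (a', b) \<in> biadd_rels"
| right: "frag_of (a, b + b') - frag_of (a, b) - frag_of (a, b') \<in> biadd_rels"

lemma biadd_rels_minus: "x \<in> biadd_rels \<Longrightarrow> - x \<in> biadd_rels"
  using biadd_rels.diff[OF biadd_rels.zero, of x] by simp

lemma biadd_rels_add: "x \<in> biadd_rels \<Longrightarrow> y \<in> biadd_rels \<Longrightarrow> x + y \<in> biadd_rels"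
  using biadd_rels.diff[OF _ biadd_rels_minus, of x y] by simp

definition tensor_rel ::
  "(('a::ab_group_add \<times> 'b::ab_group_add) \<Rightarrow>\<^sub>0 int) \<Rightarrow> (('a \<times> 'b) \<Rightarrow>\<^sub>0 int) \<Rightarrow> bool" where
  "tensor_rel x y \<longleftrightarrow> x - y \<in> biadd_rels"

lemma equivp_tensor_rel: "equivp tensor_rel"
proof (rule equivpI)
  show "reflp tensor_rel"
    by (simp add: reflp_def tensor_rel_def biadd_rels.zero)
  show "symp tensor_rel"
    unfolding symp_def tensor_rel_def using biadd_rels_minus by fastforce
  show "transp tensor_rel"
    unfolding transp_def tensor_rel_def using biadd_rels_add by fastforce
qed

quotient_type (overloaded) ('a, 'b) tensor =
  "('a::ab_group_add \<times> 'b::ab_group_add) \<Rightarrow>\<^sub>0 int" / tensor_rel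
  by (rule equivp_tensor_rel)

instantiation tensor :: (ab_group_add, ab_group_add) ab_group_add
begin

lift_definition zero_tensor :: "('a, 'b) tensor" is 0 .

lift_definition plus_tensor :: "('a, 'b) tensor \<Rightarrow> ('a, 'b) tensor \<Rightarrow> ('a, 'b) tensor" is "(+)"
proof -
  fix x x' y y' :: "('a \<times> 'b) \<Rightarrow>\<^sub>0 int"
  have eq: "x + y - (x' + y') = (x - x') + (y - y')" by simp
  show "tensor_rel x x' \<Longrightarrow> tensor_rel y y' \<Longrightarrow> tensor_rel (x + y) (x' + y')"
    unfolding tensor_rel_def eq by (rule biadd_rels_add)
qed

lift_definition uminus_tensor :: "('a, 'b) tensor \<Rightarrow> ('a, 'b) tensor" is "uminus"
proof -
  fix x x' :: "('a \<times> 'b) \<Rightarrow>\<^sub>0 int"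
  have eq: "- x - - x' = - (x - x')" by simp
  show "tensor_rel x x' \<Longrightarrow> tensor_rel (- x) (- x')"
    unfolding tensor_rel_def eq by (rule biadd_rels_minus)
qed

definition minus_tensor :: "('a, 'b) tensor \<Rightarrow> ('a, 'b) tensor \<Rightarrow> ('a, 'b) tensor" where
  "minus_tensor x y = x + - y"

instance
proof
  fix a b c :: "('a, 'b) tensor"
  show "a + b + c = a + (b + c)"
    by transfer (simp only: add.assoc tensor_rel_def diff_self biadd_rels.zero)
  show "a + b = b + a"
    by transfer (simp only: add.commute tensor_rel_def diff_self biadd_rels.zero)
  show "0 + a = a"
    by transfer (simp only: add_0_left tensor_rel_def diff_self biadd_rels.zero)
  show "- a + a = 0"
    by transfer (simp only: left_minus tensor_rel_def diff_self biadd_rels.zero)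
  show "a - b = a + - b"
    by (rule minus_tensor_def)
qed

end

lift_definition tens :: "'a::ab_group_add \<Rightarrow> 'b::ab_group_add \<Rightarrow> ('a, 'b) tensor"
  (infix "\<otimes>\<^sub>Z" 75) is "\<lambda>a b. frag_of (a, b)" .

lemma tens_add_left: "(a + a') \<otimes>\<^sub>Z b = a \<otimes>\<^sub>Z b + a' \<otimes>\<^sub>Z b"
  by transfer (use biadd_rels.left in \<open>simp add: tensor_rel_def diff_diff_eq\<close>)

lemma tens_add_right: "a \<otimes>\<^sub>Z (b + b') = a \<otimes>\<^sub>Z b + a \<otimes>\<^sub>Z b'"
  by transfer (use biadd_rels.right in \<open>simp add: tensor_rel_def diff_diff_eq\<close>)


section \<open>The polynomial ring and Schur polynomials\<close>

text \<open>
  Indices are shifted by one: entry \<open>i\<close> (from 0) of an \<open>int_vec\<close> is the mathematical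
  \<open>\<alpha>\<^bsub>i+1\<^esub>\<close>, and the indeterminate with number \<open>i\<close> of the monomial type \<open>nat \<Rightarrow>\<^sub>0 nat\<close> is \<open>u\<^bsub>i+1\<^esub>\<close>.
\<close>

type_synonym int_vec = "nat \<Rightarrow>\<^sub>0 int"

type_synonym A = "(nat \<Rightarrow>\<^sub>0 nat) \<Rightarrow>\<^sub>0 int"

definition is_partition :: "int_vec \<Rightarrow> bool" where
  "is_partition \<alpha> \<longleftrightarrow>
     (\<forall>i. Poly_Mapping.lookup \<alpha> i \<ge> Poly_Mapping.lookup \<alpha> (Suc i) \<and>
          Poly_Mapping.lookup \<alpha> (Suc i) \<ge> 0)"

definition vec_sum :: "int_vec \<Rightarrow> int" where
  "vec_sum \<alpha> = (\<Sum>i\<in>Poly_Mapping.keys \<alpha>. Poly_Mapping.lookup \<alpha> i)"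

definition partitions_of :: "nat \<Rightarrow> int_vec set" where
  "partitions_of n = {\<alpha>. is_partition \<alpha> \<and> vec_sum \<alpha> = int n}"

definition u :: "int \<Rightarrow> A" where
  "u r = (if r < 0 then 0 else if r = 0 then 1
          else Poly_Mapping.single (Poly_Mapping.single (nat r - 1) 1) 1)"

definition u_vec :: "int_vec \<Rightarrow> A" where
  "u_vec \<alpha> = (\<Prod>i\<in>Poly_Mapping.keys \<alpha>. u (Poly_Mapping.lookup \<alpha> i))"

definition raise :: "nat \<Rightarrow> nat \<Rightarrow> int_vec \<Rightarrow> int_vec" where
  "raise i j \<alpha> = \<alpha> + Poly_Mapping.single i 1 - Poly_Mapping.single j 1"

text \<open>The raising operator that is the product of the \<open>R\<^bsub>ij\<^esub>\<close> with \<open>(i, j) \<in> S\<close>, for finite \<open>S\<close>.\<close>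

definition raise_all :: "(nat \<times> nat) set \<Rightarrow> int_vec \<Rightarrow> int_vec" where
  "raise_all S \<alpha> = Finite_Set.fold (\<lambda>(i, j). raise i j) \<alpha> S"

text \<open>
  Expanding the product of the factors \<open>1 - R\<^bsub>ij\<^esub>\<close>, one picks \<open>- R\<^bsub>ij\<^esub>\<close> from the factors
  in a finite set \<open>S\<close> and \<open>1\<close> from all others. Only finitely many of the summands are nonzero
  (lemma \<open>finite_schur_support\<close>), so \<open>Sum_any\<close> is a proper sum.
\<close>

definition schur :: "int_vec \<Rightarrow> A" where
  "schur \<alpha> = Sum_any (\<lambda>S. if finite S \<and> S \<subseteq> {(i, j). i < j}
                          then (- 1) ^ card S * u_vec (raise_all S \<alpha>) else 0)"

definition kostka :: "int_vec \<Rightarrow> int_vec \<Rightarrow> int" where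
  "kostka la \<mu> = Poly_Mapping.lookup
     (THE k :: int_vec \<Rightarrow>\<^sub>0 int.
        Poly_Mapping.keys k \<subseteq> Collect is_partition \<and>
        u_vec \<mu> = (\<Sum>\<nu>\<in>Poly_Mapping.keys k. of_int (Poly_Mapping.lookup k \<nu>) * schur \<nu>)) la"

text \<open>
  The family \<open>t\<close> is indexed by partitions only; the value 0 elsewhere makes it unique as a
  function on all integer vectors.
\<close>

definition t_poly :: "int_vec \<Rightarrow> A" where
  "t_poly = (THE t.
     (\<forall>la. is_partition la \<longrightarrow>
        schur la = (\<Sum>\<mu> | is_partition \<mu> \<and> kostka la \<mu> \<noteq> 0. of_int (kostka la \<mu>) * t \<mu>)) \<and>
     (\<forall>\<alpha>. \<not> is_partition \<alpha> \<longrightarrow> t \<alpha> = 0))"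

definition ones :: "nat \<Rightarrow> int_vec" where
  "ones r = (\<Sum>i<r. Poly_Mapping.single i 1)"

definition v :: "int \<Rightarrow> A" where
  "v r = (if r < 0 then 0 else if r = 0 then 1 else schur (ones (nat r)))"

definition v_vec :: "int_vec \<Rightarrow> A" where
  "v_vec \<alpha> = (\<Prod>i\<in>Poly_Mapping.keys \<alpha>. v (Poly_Mapping.lookup \<alpha> i))"

text \<open>
  The ring homomorphism substituting \<open>v r\<close> for \<open>u r\<close>
  (lemmas \<open>omega_one\<close>, \<open>omega_add\<close>, \<open>omega_mult\<close>, \<open>omega_u\<close>).
\<close>

definition omega_mono :: "(nat \<Rightarrow>\<^sub>0 nat) \<Rightarrow> A" where
  "omega_mono m = (\<Prod>i\<in>Poly_Mapping.keys m. v (int (Suc i)) ^ Poly_Mapping.lookup m i)"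

definition omega :: "A \<Rightarrow> A" where
  "omega p = (\<Sum>m\<in>Poly_Mapping.keys p. of_int (Poly_Mapping.lookup p m) * omega_mono m)"

definition V :: "int_vec \<Rightarrow> A" where
  "V la = omega (schur la)"


section \<open>Formal sums\<close>

text \<open>
  \<open>A\<close> is graded by giving \<open>u r\<close> degree \<open>r\<close>, so the tensor square is bigraded. A formal sum is
  an element of the completion, that is, of the product of all bihomogeneous pieces.
\<close>

definition mono_deg :: "(nat \<Rightarrow>\<^sub>0 nat) \<Rightarrow> nat" where
  "mono_deg m = (\<Sum>i\<in>Poly_Mapping.keys m. Suc i * Poly_Mapping.lookup m i)"

definition hom_part :: "nat \<Rightarrow> A \<Rightarrow> A" where
  "hom_part d = frag_extend (\<lambda>m. if mono_deg m = d then frag_of m else 0)"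

lemma hom_part_add: "hom_part d (p + q) = hom_part d p + hom_part d q"
  by (simp add: hom_part_def frag_extend_add)

lift_definition bihom_part :: "nat \<Rightarrow> nat \<Rightarrow> (A, A) tensor \<Rightarrow> (A, A) tensor"
  is "\<lambda>d e. frag_extend (\<lambda>(a, b). frag_of (hom_part d a, hom_part e b))"
proof -
  fix d e :: nat and x y :: "(A \<times> A) \<Rightarrow>\<^sub>0 int"
  define h where "h = frag_extend (\<lambda>(a, b). frag_of (hom_part d a, hom_part e b))"
  have "h z \<in> biadd_rels" if "z \<in> biadd_rels" for z
    using that
  proof induction
    case zero
    show ?case by (simp add: h_def biadd_rels.zero)
  next
    case (diff x y)
    then show ?case by (simp add: h_def frag_extend_diff biadd_rels.diff)
  next
    case (left a a' b)
    show ?case by (simp add: h_def frag_extend_diff hom_part_add biadd_rels.left)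
  next
    case (right a b b')
    show ?case by (simp add: h_def frag_extend_diff hom_part_add biadd_rels.right)
  qed
  then show "tensor_rel x y \<Longrightarrow> tensor_rel
      (frag_extend (\<lambda>(a, b). frag_of (hom_part d a, hom_part e b)) x)
      (frag_extend (\<lambda>(a, b). frag_of (hom_part d a, hom_part e b)) y)"
    by (simp add: tensor_rel_def h_def flip: frag_extend_diff)
qed

lemma bihom_part_tens: "bihom_part d e (a \<otimes>\<^sub>Z b) = hom_part d a \<otimes>\<^sub>Z hom_part e b"
  by transfer (simp add: tensor_rel_def biadd_rels.zero)

definition formally_summable :: "('i \<Rightarrow> (A, A) tensor) \<Rightarrow> 'i set \<Rightarrow> bool" where
  "formally_summable F I \<longleftrightarrow> (\<forall>d e. finite {i\<in>I. bihom_part d e (F i) \<noteq> 0})"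

definition formal_sum :: "('i \<Rightarrow> (A, A) tensor) \<Rightarrow> 'i set \<Rightarrow> nat \<Rightarrow> nat \<Rightarrow> (A, A) tensor" where
  "formal_sum F I d e = (\<Sum>i | i \<in> I \<and> bihom_part d e (F i) \<noteq> 0. bihom_part d e (F i))"


section \<open>Well-definedness facts\<close>

lemma raise_comm: "raise i j \<circ> raise k l = raise k l \<circ> raise i j"
  by (rule ext) (simp add: raise_def algebra_simps)

interpretation raise: comp_fun_commute "\<lambda>(i, j). raise i j"
  by unfold_locales (auto simp: raise_comm split: prod.split)

lemma raise_all_empty: "raise_all {} \<alpha> = \<alpha>"
  by (simp add: raise_all_def)

lemma raise_all_insert:
  "finite S \<Longrightarrow> (i, j) \<notin> S \<Longrightarrow> raise_all (insert (i, j) S) \<alpha> = raise i j (raise_all S \<alpha>)"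
  by (simp add: raise_all_def)

lemma lookup_raise_all:
  assumes "finite S"
  shows "Poly_Mapping.lookup (raise_all S \<alpha>) n =
     Poly_Mapping.lookup \<alpha> n + (\<Sum>(i, j)\<in>S. of_bool (i = n) - of_bool (j = n))"
  using assms
proof (induction S)
  case empty
  then show ?case by (simp add: raise_all_empty)
next
  case (insert x S)
  then show ?case
    by (cases x)
      (auto simp: raise_all_insert raise_def lookup_add lookup_minus lookup_single when_def)
qed

lemma u_vec_eq_0:
  assumes "Poly_Mapping.lookup \<alpha> n < 0"
  shows "u_vec \<alpha> = 0"
proof -
  have "n \<in> Poly_Mapping.keys \<alpha>" using assms by (simp add: in_keys_iff)
  moreover have "u (Poly_Mapping.lookup \<alpha> n) = 0" using assms by (simp add: u_def)
  ultimately show ?thesis unfolding u_vec_def by (intro prod_zero) auto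
qed

lemma finite_schur_support:
  "finite {S. finite S \<and> S \<subseteq> {(i, j). i < j} \<and> u_vec (raise_all S \<alpha>) \<noteq> 0}"
proof -
  obtain N where N: "\<And>n. n \<ge> N \<Longrightarrow> Poly_Mapping.lookup \<alpha> n = 0"
  proof -
    have "n \<notin> Poly_Mapping.keys \<alpha>" if "n \<ge> Suc (Max (Poly_Mapping.keys \<alpha>))" for n
      using that Max_ge[of "Poly_Mapping.keys \<alpha>" n] by fastforce
    then show ?thesis using that by (metis in_keys_iff)
  qed
  have "S \<subseteq> {..<N} \<times> {..<N}"
    if S: "finite S" "S \<subseteq> {(i, j). i < j}" "u_vec (raise_all S \<alpha>) \<noteq> 0" for S
  proof (rule ccontr)
    assume "\<not> S \<subseteq> {..<N} \<times> {..<N}"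
    then obtain i j where ij: "(i, j) \<in> S" "j \<ge> N" using S(2) by force
    define m where "m = Max (snd ` S)"
    have m_in: "m \<in> snd ` S" unfolding m_def using S(1) ij by (intro Max_in) auto
    have m_ge: "b \<le> m" if "(a, b) \<in> S" for a b
      unfolding m_def using S(1) that by (force intro: Max_ge)
    then have "m \<ge> N" using ij by fastforce
    obtain k where k: "(k, m) \<in> S" using m_in by auto
    have no: "a \<noteq> m" if "(a, b) \<in> S" for a b
      using m_ge[OF that] S(2) that by auto
    have "(\<Sum>(a, b)\<in>S. of_bool (a = m) - of_bool (b = m) :: int) < (\<Sum>_\<in>S. 0)"
    proof (rule sum_strict_mono_ex1)
      show "\<forall>x\<in>S. (case x of (a, b) \<Rightarrow> of_bool (a = m) - of_bool (b = m)) \<le> (0 :: int)"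
        using no by auto
      show "\<exists>x\<in>S. (case x of (a, b) \<Rightarrow> of_bool (a = m) - of_bool (b = m)) < (0 :: int)"
        using no[OF k] by (intro bexI[OF _ k]) simp
    qed (rule S(1))
    then have "Poly_Mapping.lookup (raise_all S \<alpha>) m < 0"
      using N[OF \<open>m \<ge> N\<close>] S(1) by (simp add: lookup_raise_all)
    then show False using S(3) u_vec_eq_0 by blast
  qed
  then have "{S. finite S \<and> S \<subseteq> {(i, j). i < j} \<and> u_vec (raise_all S \<alpha>) \<noteq> 0}
      \<subseteq> Pow ({..<N} \<times> {..<N})" by blast
  then show ?thesis by (rule finite_subset) simp
qed

lemma lookup_partition_nonneg:
  assumes "is_partition \<alpha>"
  shows "Poly_Mapping.lookup \<alpha> i \<ge> 0"
  using assms unfolding is_partition_def by (metis order_trans)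

lemma finite_partitions_of: "finite (partitions_of n)"
proof -
  have bound: "Poly_Mapping.lookup \<alpha> i \<in> {0..int n} \<and> (i \<ge> n \<longrightarrow> Poly_Mapping.lookup \<alpha> i = 0)"
    if \<alpha>: "\<alpha> \<in> partitions_of n" for \<alpha> i
  proof -
    have part: "is_partition \<alpha>" and sum: "vec_sum \<alpha> = int n"
      using \<alpha> by (auto simp: partitions_of_def)
    note nonneg = lookup_partition_nonneg[OF part]
    have anti: "Poly_Mapping.lookup \<alpha> b \<le> Poly_Mapping.lookup \<alpha> a" if "a \<le> b" for a b
      using that by (rule lift_Suc_antimono_le[rotated]) (use part in \<open>simp add: is_partition_def\<close>)
    have le: "Poly_Mapping.lookup \<alpha> i \<le> int n"
    proof (cases "i \<in> Poly_Mapping.keys \<alpha>")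
      case True
      then show ?thesis unfolding sum[symmetric] vec_sum_def
        by (intro member_le_sum) (auto simp: nonneg)
    next
      case False
      then show ?thesis by (simp add: in_keys_iff)
    qed
    have "Poly_Mapping.lookup \<alpha> i = 0" if "i \<ge> n"
    proof (rule ccontr)
      assume "Poly_Mapping.lookup \<alpha> i \<noteq> 0"
      then have pos: "Poly_Mapping.lookup \<alpha> k \<ge> 1" if "k \<le> i" for k
        using anti[OF that] nonneg[of i] by linarith
      have sub: "{..i} \<subseteq> Poly_Mapping.keys \<alpha>"
      proof
        fix k assume "k \<in> {..i}"
        then show "k \<in> Poly_Mapping.keys \<alpha>" using pos[of k] by (simp add: in_keys_iff)
      qed
      have "int (Suc i) = (\<Sum>k\<le>i. 1)" by simp
      also have "\<dots> \<le> (\<Sum>k\<le>i. Poly_Mapping.lookup \<alpha> k)" by (intro sum_mono pos) simp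
      also have "\<dots> \<le> vec_sum \<alpha>" unfolding vec_sum_def
        using sub nonneg by (intro sum_mono2) simp_all
      finally show False using sum that by simp
    qed
    then show ?thesis using le nonneg by simp
  qed
  have "Poly_Mapping.lookup ` partitions_of n
      \<subseteq> {f. \<forall>i. (i \<in> {..<n} \<longrightarrow> f i \<in> {0..int n}) \<and> (i \<notin> {..<n} \<longrightarrow> f i = 0)}"
    (is "_ \<subseteq> ?F")
  proof
    fix f assume "f \<in> Poly_Mapping.lookup ` partitions_of n"
    then obtain \<alpha> where \<alpha>: "\<alpha> \<in> partitions_of n" "f = Poly_Mapping.lookup \<alpha>" by blast
    show "f \<in> ?F"
      unfolding \<alpha>(2) mem_Collect_eq lessThan_iff not_less using bound[OF \<alpha>(1)] by blast
  qed
  moreover have "finite ?F" by (intro finite_set_of_finite_funs) simp_all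
  ultimately have "finite (Poly_Mapping.lookup ` partitions_of n)" by (rule finite_subset)
  then show ?thesis
    by (rule finite_imageD) (simp add: inj_on_def)
qed

lemma omega_superset:
  assumes "finite M" "Poly_Mapping.keys p \<subseteq> M"
  shows "omega p = (\<Sum>m\<in>M. of_int (Poly_Mapping.lookup p m) * omega_mono m)"
  unfolding omega_def using assms
  by (intro sum.mono_neutral_left) (auto simp: in_keys_iff)

lemma omega_add: "omega (p + q) = omega p + omega q"
proof -
  define M where "M = Poly_Mapping.keys p \<union> Poly_Mapping.keys q"
  have M: "finite M" "Poly_Mapping.keys p \<subseteq> M" "Poly_Mapping.keys q \<subseteq> M"
      "Poly_Mapping.keys (p + q) \<subseteq> M"
    using keys_add[of p q] by (auto simp: M_def)
  show ?thesis
    by (simp add: omega_superset[OF M(1)] M lookup_add distrib_right sum.distrib)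
qed

lemma omega_single: "omega (Poly_Mapping.single m c) = of_int c * omega_mono m"
  by (subst omega_superset[of "{m}"]) auto

lemma omega_mono_superset:
  assumes "finite I" "Poly_Mapping.keys m \<subseteq> I"
  shows "omega_mono m = (\<Prod>i\<in>I. v (int (Suc i)) ^ Poly_Mapping.lookup m i)"
  unfolding omega_mono_def using assms
  by (intro prod.mono_neutral_left) (auto simp: in_keys_iff)

lemma omega_mono_add: "omega_mono (m + m') = omega_mono m * omega_mono m'"
proof -
  define I where "I = Poly_Mapping.keys m \<union> Poly_Mapping.keys m'"
  have I: "finite I" "Poly_Mapping.keys m \<subseteq> I" "Poly_Mapping.keys m' \<subseteq> I"
      "Poly_Mapping.keys (m + m') \<subseteq> I"
    using keys_add[of m m'] by (auto simp: I_def)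
  show ?thesis
    by (simp add: omega_mono_superset[OF I(1)] I lookup_add power_add prod.distrib)
qed

lemma omega_zero: "omega 0 = 0"
  by (simp add: omega_def)

lemma omega_minus: "omega (- p) = - omega p"
  using omega_add[of "- p" p] by (simp add: omega_zero add_eq_0_iff2)

lemma omega_diff: "omega (p - q) = omega p - omega q"
  using omega_add[of p "- q"] by (simp add: omega_minus)

lemma omega_one: "omega 1 = 1"
proof -
  have "omega 1 = omega (Poly_Mapping.single 0 1)" by simp
  also have "\<dots> = 1" unfolding omega_single by (simp add: omega_mono_def)
  finally show ?thesis .
qed

lemma omega_mult: "omega (p * q) = omega p * omega q"
proof -
  have single: "omega (frag_of m * q) = omega_mono m * omega q" for m
  proof (induction q rule: frag_induction[OF subset_UNIV])
    case 1
    show ?case by (simp add: omega_zero)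
  next
    case (2 x)
    show ?case by (simp add: mult_single omega_single omega_mono_add)
  next
    case (3 a b)
    then show ?case by (simp add: algebra_simps omega_diff)
  qed
  show ?thesis
  proof (induction p rule: frag_induction[OF subset_UNIV])
    case 1
    show ?case by (simp add: omega_zero)
  next
    case (2 x)
    show ?case by (simp add: single omega_single)
  next
    case (3 a b)
    then show ?case by (simp add: algebra_simps omega_diff)
  qed
qed

lemma omega_u: "omega (u r) = v r"
proof (cases "r > 0")
  case True
  then have "omega_mono (Poly_Mapping.single (nat r - 1) 1) = v r"
    by (simp add: omega_mono_def)
  then show ?thesis using True by (simp add: u_def omega_single)
next
  case False
  then show ?thesis by (auto simp: u_def v_def omega_zero omega_one)
qed

end

theory Submission
  imports Defs
begin

text \<open>
  Write \<open>K\<close> for the Kostka matrix, and recall that \<open>U\<^sub>\<lambda> = \<Sum>\<^sub>\<mu> K\<^sub>\<lambda>\<^sub>\<mu> t\<^sub>\<mu>\<close> defines \<open>t\<close>, while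
  \<open>u\<^sub>\<mu> = \<Sum>\<^sub>\<lambda> K\<^sub>\<lambda>\<^sub>\<mu> U\<^sub>\<lambda>\<close> defines \<open>K\<close>. Moving the integers \<open>K\<^sub>\<lambda>\<^sub>\<mu>\<close> across the tensor sign
  turns \<open>\<Sum>\<^sub>\<lambda> U\<^sub>\<lambda> \<otimes> V\<^sub>\<lambda>\<close> into \<open>\<Sum>\<^sub>\<mu> t\<^sub>\<mu> \<otimes> (\<Sum>\<^sub>\<lambda> K\<^sub>\<lambda>\<^sub>\<mu> V\<^sub>\<lambda>)\<close>, and the second factor is
  \<open>\<omega>(u\<^sub>\<mu>) = v\<^sub>\<mu>\<close> because \<open>\<omega>\<close> is a ring homomorphism (\<open>dual_cauchy_degree\<close>).

  The work lies in showing that both definitions have unique solutions, that is, that the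
  \<open>U\<^sub>\<lambda>\<close> form a basis and \<open>K\<close> is invertible over the integers, degree by degree. Partitions
  correspond bijectively to monomials \<open>u\<^sub>\<lambda>\<close>. Applying a nonempty product of raising operators
  to a partition \<open>\<lambda>\<close> adds a nonzero sum \<open>\<delta>\<close> of positive roots, and
  \<open>|\<lambda> + \<delta>|\<^sup>2 = |\<lambda>|\<^sup>2 + 2(\<lambda>, \<delta>) + |\<delta>|\<^sup>2 > |\<lambda>|\<^sup>2\<close>
  since a partition pairs nonnegatively with positive roots. The sum of squares is symmetric in
  the entries, hence a function of the monomial, so \<open>U\<^sub>\<lambda>\<close> equals \<open>u\<^sub>\<lambda>\<close> plus monomials of the same
  degree and strictly larger square sum (\<open>schur_unitriangular\<close>). This plays the role of
  triangularity in dominance order without any sorting of exponents, and yields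
  \<open>schur_span\<close> and \<open>schur_independent\<close>. The matrix of \<open>U\<close> in terms of \<open>u\<close> is then a two-sided
  inverse of \<open>K\<close>, which determines \<open>t\<close> (\<open>t_poly_expansions\<close>).

  For the formal sums, \<open>U\<^sub>\<lambda>\<close> and \<open>t\<^sub>\<lambda>\<close> are homogeneous of degree \<open>|\<lambda>|\<close>, so each bihomogeneous
  component sees only the partitions of one integer.
\<close>

section \<open>Partitions and monomials\<close>

lemma mem_downset_iff:
  fixes X :: "nat set"
  assumes "finite X" and down: "\<And>x y. y \<in> X \<Longrightarrow> x \<le> y \<Longrightarrow> x \<in> X"
  shows "x \<in> X \<longleftrightarrow> x < card X"
proof -
  have eq: "X = {..<card X}"
  proof (cases "X = {}")
    case False
    then have "Max X \<in> X" using assms(1) by simp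
    then have "X = {..Max X}"
      using Max_ge[OF assms(1)] down[OF \<open>Max X \<in> X\<close>] by blast
    then obtain n where "X = {..n}" ..
    then show ?thesis by (simp flip: lessThan_Suc_atMost)
  qed simp
  show ?thesis by (subst eq) (rule lessThan_iff)
qed

definition weighted :: "(nat \<Rightarrow> nat) \<Rightarrow> (nat \<Rightarrow>\<^sub>0 nat) \<Rightarrow> nat" where
  "weighted f m = (\<Sum>i\<in>Poly_Mapping.keys m. f i * Poly_Mapping.lookup m i)"

lemma weighted_superset:
  assumes "finite I" "Poly_Mapping.keys m \<subseteq> I"
  shows "weighted f m = (\<Sum>i\<in>I. f i * Poly_Mapping.lookup m i)"
  unfolding weighted_def using assms
  by (intro sum.mono_neutral_left) (auto simp: in_keys_iff)

lemma weighted_zero: "weighted f 0 = 0"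
  by (simp add: weighted_def)

lemma weighted_add: "weighted f (m + m') = weighted f m + weighted f m'"
proof -
  define I where "I = Poly_Mapping.keys m \<union> Poly_Mapping.keys m'"
  have I: "finite I" "Poly_Mapping.keys m \<subseteq> I" "Poly_Mapping.keys m' \<subseteq> I"
      "Poly_Mapping.keys (m + m') \<subseteq> I"
    using keys_add[of m m'] by (auto simp: I_def)
  show ?thesis
    by (simp add: weighted_superset[OF I(1)] I lookup_add distrib_left sum.distrib)
qed

lemma weighted_sum: "weighted f (\<Sum>i\<in>I. g i) = (\<Sum>i\<in>I. weighted f (g i))"
  by (induction I rule: infinite_finite_induct) (simp_all add: weighted_zero weighted_add)

text \<open>
  The exponent vector of \<open>u\<^sub>\<beta>\<close>. It is meaningful only when all entries of \<open>\<beta>\<close> are nonnegative;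
  the subtraction of one matches the numbering of the indeterminates.
\<close>
definition mono_of :: "int_vec \<Rightarrow> (nat \<Rightarrow>\<^sub>0 nat)" where
  "mono_of \<beta> = (\<Sum>i\<in>Poly_Mapping.keys \<beta>.
     Poly_Mapping.single (nat (Poly_Mapping.lookup \<beta> i) - 1) 1)"

lemma u_vec_eq_mono:
  assumes "\<And>i. Poly_Mapping.lookup \<beta> i \<ge> 0"
  shows "u_vec \<beta> = frag_of (mono_of \<beta>)"
proof -
  have prod_single: "(\<Prod>i\<in>I. frag_of (g i)) = frag_of (\<Sum>i\<in>I. g i)"
    if "finite I" for I :: "nat set" and g :: "nat \<Rightarrow> nat \<Rightarrow>\<^sub>0 nat"
    using that by induction (simp_all add: mult_single)
  have "u (Poly_Mapping.lookup \<beta> i) =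
      frag_of (Poly_Mapping.single (nat (Poly_Mapping.lookup \<beta> i) - 1) 1)"
    if "i \<in> Poly_Mapping.keys \<beta>" for i
    using assms[of i] that by (simp add: u_def in_keys_iff)
  then show ?thesis unfolding u_vec_def mono_of_def
    by (simp add: prod_single)
qed

text \<open>
  Functions of \<open>\<beta>\<close> that are sums over its nonzero entries, such as the size, the square sum and
  the number of entries above a bound, depend only on the monomial \<open>u\<^sub>\<beta>\<close>, and linearly so.
\<close>
lemma weighted_mono_of:
  "weighted f (mono_of \<beta>) = (\<Sum>i\<in>Poly_Mapping.keys \<beta>. f (nat (Poly_Mapping.lookup \<beta> i) - 1))"
  unfolding mono_of_def weighted_sum by (simp add: weighted_def)

text \<open>
  For the monomial of a partition, this is the conjugate partition.
\<close>
abbreviation tail :: "(nat \<Rightarrow>\<^sub>0 nat) \<Rightarrow> nat \<Rightarrow> nat" where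
  "tail m r \<equiv> weighted (\<lambda>s. of_bool (r \<le> s)) m"

lemma tail_mono_of:
  assumes "\<And>i. Poly_Mapping.lookup \<beta> i \<ge> 0"
  shows "tail (mono_of \<beta>) r = card {i. Poly_Mapping.lookup \<beta> i > int r}"
proof -
  have "tail (mono_of \<beta>) r =
      card {i \<in> Poly_Mapping.keys \<beta>. r \<le> nat (Poly_Mapping.lookup \<beta> i) - 1}"
    unfolding weighted_mono_of by (simp add: sum.If_cases of_bool_def Int_def)
  also have "{i \<in> Poly_Mapping.keys \<beta>. r \<le> nat (Poly_Mapping.lookup \<beta> i) - 1} =
      {i. Poly_Mapping.lookup \<beta> i > int r}"
  proof (rule Collect_cong)
    show "i \<in> Poly_Mapping.keys \<beta> \<and> r \<le> nat (Poly_Mapping.lookup \<beta> i) - 1 \<longleftrightarrow>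
        Poly_Mapping.lookup \<beta> i > int r" for i
      using assms[of i] by (auto simp: in_keys_iff)
  qed
  finally show ?thesis .
qed

lemma tail_eq_imp_eq:
  assumes "\<And>r. tail m r = tail m' r"
  shows "m = m'"
proof (rule poly_mapping_eqI)
  have "tail m r = Poly_Mapping.lookup m r + tail m (Suc r)" for m r
  proof -
    define I where "I = insert r (Poly_Mapping.keys m)"
    have I: "finite I" "Poly_Mapping.keys m \<subseteq> I" "r \<in> I" by (auto simp: I_def)
    have "tail m r = (\<Sum>i\<in>I. of_bool (i = r) * Poly_Mapping.lookup m i
        + of_bool (Suc r \<le> i) * Poly_Mapping.lookup m i)"
      unfolding weighted_superset[OF I(1,2)] by (intro sum.cong) auto
    also have "\<dots> = Poly_Mapping.lookup m r + tail m (Suc r)"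
      unfolding weighted_superset[OF I(1,2)] using I by (simp add: sum.distrib)
    finally show ?thesis .
  qed
  then show "Poly_Mapping.lookup m r = Poly_Mapping.lookup m' r" for r
    using assms by (metis add_right_cancel)
qed

lemma partition_antimono:
  assumes "is_partition \<alpha>" "a \<le> b"
  shows "Poly_Mapping.lookup \<alpha> b \<le> Poly_Mapping.lookup \<alpha> a"
  using assms(2)
  by (rule lift_Suc_antimono_le[rotated]) (use assms(1) in \<open>simp add: is_partition_def\<close>)

text \<open>
  The two conjugate partitions describe the same Young diagram, by rows and by columns. This
  recovers a partition from its monomial.
\<close>
lemma partition_entry_greater_iff:
  assumes "is_partition la"
  shows "Poly_Mapping.lookup la i > int r \<longleftrightarrow> i < tail (mono_of la) r"
proof -
  have "finite {i. Poly_Mapping.lookup la i > int r}"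
    by (rule finite_subset[of _ "Poly_Mapping.keys la"]) (auto simp: in_keys_iff)
  then have "i \<in> {i. Poly_Mapping.lookup la i > int r} \<longleftrightarrow>
      i < card {i. Poly_Mapping.lookup la i > int r}"
    by (rule mem_downset_iff) (use partition_antimono[OF assms] in fastforce)
  then show ?thesis
    by (simp add: tail_mono_of lookup_partition_nonneg[OF assms])
qed

lemma mono_of_inj:
  assumes "is_partition la" "is_partition mu" "mono_of la = mono_of mu"
  shows "la = mu"
proof (rule poly_mapping_eqI)
  fix i
  have "Poly_Mapping.lookup la i > int r \<longleftrightarrow> Poly_Mapping.lookup mu i > int r" for r
    using assms by (simp add: partition_entry_greater_iff)
  from this[of "nat (Poly_Mapping.lookup la i)"] this[of "nat (Poly_Mapping.lookup mu i)"]
  show "Poly_Mapping.lookup la i = Poly_Mapping.lookup mu i"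
    using lookup_partition_nonneg[OF assms(1), of i] lookup_partition_nonneg[OF assms(2), of i]
    by auto
qed

text \<open>
  The monomial \<open>m\<close> is the image of the conjugate of its tail sums: conjugation makes the entries
  sorted without any sorting procedure.
\<close>
lemma mono_of_surj: "\<exists>la. is_partition la \<and> mono_of la = m"
proof -
  have tail_anti: "tail m s \<le> tail m r" if "r \<le> s" for r s
  proof -
    have "of_bool (s \<le> i) \<le> (of_bool (r \<le> i) :: nat)" for i
      using that by (simp add: of_bool_def)
    then show ?thesis
      unfolding weighted_def by (intro sum_mono mult_right_mono) simp_all
  qed
  have "{r. i < tail m r} \<subseteq> {..Max (Poly_Mapping.keys m)}" for i
  proof
    fix r assume "r \<in> {r. i < tail m r}"
    then have "tail m r \<noteq> 0" by simp
    then have "\<exists>s\<in>Poly_Mapping.keys m. of_bool (r \<le> s) * Poly_Mapping.lookup m s \<noteq> 0"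
      unfolding weighted_def by (rule contrapos_np) (simp add: sum.neutral)
    then obtain s where s: "s \<in> Poly_Mapping.keys m" "r \<le> s" by auto
    then show "r \<in> {..Max (Poly_Mapping.keys m)}"
      using le_trans[OF s(2) Max_ge[OF finite_keys s(1)]] by simp
  qed
  then have fin: "finite {r. i < tail m r}" for i
    by (rule finite_subset) simp
  define la where "la = Abs_poly_mapping (\<lambda>i. int (card {r. i < tail m r}))"
  have "finite {i. int (card {r. i < tail m r}) \<noteq> 0}"
  proof (rule finite_subset)
    show "{i. int (card {r. i < tail m r}) \<noteq> 0} \<subseteq> {..<tail m 0}"
    proof
      fix i assume "i \<in> {i. int (card {r. i < tail m r}) \<noteq> 0}"
      then obtain r where "i < tail m r" by fastforce
      then show "i \<in> {..<tail m 0}" using tail_anti[of 0 r] by simp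
    qed
  qed simp
  then have la: "Poly_Mapping.lookup la i = int (card {r. i < tail m r})" for i
    unfolding la_def by simp
  have part: "is_partition la"
    unfolding is_partition_def la by (auto intro!: card_mono fin)
  have "Poly_Mapping.lookup la i > int r \<longleftrightarrow> i < tail m r" for i r
  proof -
    have "r \<in> {r. i < tail m r} \<longleftrightarrow> r < card {r. i < tail m r}"
      by (rule mem_downset_iff[OF fin]) (use tail_anti less_le_trans in blast)
    then show ?thesis by (simp add: la)
  qed
  then have "tail (mono_of la) r = tail m r" for r
    by (simp add: tail_mono_of lookup_partition_nonneg[OF part])
  then have "mono_of la = m" by (rule tail_eq_imp_eq)
  with part show ?thesis by blast
qed


section \<open>Unitriangularity of the Schur polynomials\<close>

definition mono_sq :: "(nat \<Rightarrow>\<^sub>0 nat) \<Rightarrow> nat" where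
  "mono_sq = weighted (\<lambda>i. (Suc i)\<^sup>2)"

lemma mono_deg_eq_weighted: "mono_deg = weighted Suc"
  by (simp add: fun_eq_iff mono_deg_def weighted_def)

lemma mono_deg_mono_of:
  assumes "\<And>i. Poly_Mapping.lookup \<beta> i \<ge> 0"
  shows "int (mono_deg (mono_of \<beta>)) = vec_sum \<beta>"
proof -
  have "int (Suc (nat (Poly_Mapping.lookup \<beta> i) - 1)) = Poly_Mapping.lookup \<beta> i"
    if "i \<in> Poly_Mapping.keys \<beta>" for i
    using assms[of i] that by (simp add: in_keys_iff)
  then show ?thesis
    unfolding mono_deg_eq_weighted weighted_mono_of vec_sum_def of_nat_sum
    by (intro sum.cong) auto
qed

lemma mono_sq_mono_of:
  assumes "\<And>i. Poly_Mapping.lookup \<beta> i \<ge> 0"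
    and "finite I" "Poly_Mapping.keys \<beta> \<subseteq> I"
  shows "int (mono_sq (mono_of \<beta>)) = (\<Sum>i\<in>I. (Poly_Mapping.lookup \<beta> i)\<^sup>2)"
proof -
  have *: "int ((Suc (nat (Poly_Mapping.lookup \<beta> i) - 1))\<^sup>2) = (Poly_Mapping.lookup \<beta> i)\<^sup>2"
    if "i \<in> Poly_Mapping.keys \<beta>" for i
  proof -
    have "int (Suc (nat (Poly_Mapping.lookup \<beta> i) - 1)) = Poly_Mapping.lookup \<beta> i"
      using assms(1)[of i] that by (simp add: in_keys_iff)
    then show ?thesis by (metis of_nat_power)
  qed
  have "int (mono_sq (mono_of \<beta>)) =
      (\<Sum>i\<in>Poly_Mapping.keys \<beta>. (Poly_Mapping.lookup \<beta> i)\<^sup>2)"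
    unfolding mono_sq_def weighted_mono_of of_nat_sum
    by (intro sum.cong) (auto simp only: *)
  also have "\<dots> = (\<Sum>i\<in>I. (Poly_Mapping.lookup \<beta> i)\<^sup>2)"
    using assms(2,3) by (intro sum.mono_neutral_left) (auto simp: in_keys_iff)
  finally show ?thesis .
qed

text \<open>
  The square sum is bounded on each degree, which makes upward induction along it terminate.
\<close>
lemma mono_sq_le: "mono_sq m \<le> (mono_deg m)\<^sup>2"
proof -
  have le: "Suc i \<le> mono_deg m" if "i \<in> Poly_Mapping.keys m" for i
  proof -
    have "1 \<le> Poly_Mapping.lookup m i" using that by (simp add: in_keys_iff)
    then have "Suc i \<le> Suc i * Poly_Mapping.lookup m i"
      using mult_le_mono2[of 1 _ "Suc i"] by simp
    also have "\<dots> \<le> mono_deg m"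
      unfolding mono_deg_def using that by (intro member_le_sum) auto
    finally show ?thesis .
  qed
  have "mono_sq m \<le> (\<Sum>i\<in>Poly_Mapping.keys m. mono_deg m * (Suc i * Poly_Mapping.lookup m i))"
    unfolding mono_sq_def weighted_def
  proof (rule sum_mono)
    fix i assume "i \<in> Poly_Mapping.keys m"
    from mult_right_mono[OF le[OF this], of "Suc i * Poly_Mapping.lookup m i"]
    show "(Suc i)\<^sup>2 * Poly_Mapping.lookup m i \<le> mono_deg m * (Suc i * Poly_Mapping.lookup m i)"
      by (simp only: power2_eq_square mult.assoc)
  qed
  also have "\<dots> = mono_deg m * mono_deg m"
    unfolding sum_distrib_left[symmetric] mono_deg_def ..
  finally show ?thesis by (simp add: power2_eq_square)
qed

lemma vec_sum_superset:
  assumes "finite I" "Poly_Mapping.keys \<alpha> \<subseteq> I"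
  shows "vec_sum \<alpha> = (\<Sum>i\<in>I. Poly_Mapping.lookup \<alpha> i)"
  unfolding vec_sum_def using assms
  by (intro sum.mono_neutral_left) (auto simp: in_keys_iff)

text \<open>
  The inner sum is coordinate \<open>n\<close> of the sum \<open>\<delta>\<close> of the positive roots in \<open>S\<close>, so this evaluates
  the pairing of \<open>f\<close> with \<open>\<delta>\<close> root by root. It serves for \<open>f = 1\<close> (raising preserves the size),
  \<open>f = \<lambda>\<close> (the cross term of the square sum) and \<open>f n = n\<close> (\<open>\<delta>\<close> is nonzero).
\<close>

lemma sum_weight_roots:
  fixes f :: "nat \<Rightarrow> int"
  assumes "finite I" "S \<subseteq> I \<times> I"
  shows "(\<Sum>n\<in>I. f n * (\<Sum>(i, j)\<in>S. of_bool (i = n) - of_bool (j = n))) =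
    (\<Sum>(i, j)\<in>S. f i - f j)"
proof -
  have pick: "(\<Sum>n\<in>I. f n * of_bool (a = n)) = f a" if "a \<in> I" for a
  proof -
    have "f n * of_bool (a = n) = (if a = n then f n else 0)" for n by simp
    then show ?thesis using assms(1) that by simp
  qed
  have "(\<Sum>n\<in>I. f n * (\<Sum>(i, j)\<in>S. of_bool (i = n) - of_bool (j = n))) =
      (\<Sum>x\<in>S. \<Sum>n\<in>I. f n * (of_bool (fst x = n) - of_bool (snd x = n)))"
    unfolding sum_distrib_left case_prod_beta by (rule sum.swap)
  also have "\<dots> = (\<Sum>x\<in>S. f (fst x) - f (snd x))"
  proof (rule sum.cong)
    fix x assume "x \<in> S"
    then have "fst x \<in> I" "snd x \<in> I" using assms(2) by auto
    then show "(\<Sum>n\<in>I. f n * (of_bool (fst x = n) - of_bool (snd x = n))) = f (fst x) - f (snd x)"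
      by (simp add: right_diff_distrib sum_subtractf pick)
  qed simp
  finally show ?thesis by (simp add: case_prod_beta)
qed

lemma finite_raise_index_set:
  assumes "finite S"
  shows "\<exists>I. finite I \<and> Poly_Mapping.keys \<alpha> \<subseteq> I \<and>
    Poly_Mapping.keys (raise_all S \<alpha>) \<subseteq> I \<and> S \<subseteq> I \<times> I"
proof (intro exI conjI)
  show "S \<subseteq> (Poly_Mapping.keys \<alpha> \<union> Poly_Mapping.keys (raise_all S \<alpha>) \<union> fst ` S \<union> snd ` S) \<times>
      (Poly_Mapping.keys \<alpha> \<union> Poly_Mapping.keys (raise_all S \<alpha>) \<union> fst ` S \<union> snd ` S)"
    by force
qed (use assms in auto)

lemma vec_sum_raise_all:
  assumes "finite S"
  shows "vec_sum (raise_all S \<alpha>) = vec_sum \<alpha>"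
proof -
  obtain I where I: "finite I" "Poly_Mapping.keys \<alpha> \<subseteq> I"
    "Poly_Mapping.keys (raise_all S \<alpha>) \<subseteq> I" "S \<subseteq> I \<times> I"
    using finite_raise_index_set[OF assms, of \<alpha>] by blast
  show ?thesis
    using sum_weight_roots[OF I(1,4), of "\<lambda>_. 1"]
    by (simp add: vec_sum_superset[OF I(1)] I(2,3) lookup_raise_all[OF assms] sum.distrib)
qed

text \<open>
  The square of \<open>\<lambda> + \<delta>\<close> exceeds that of \<open>\<lambda>\<close>: the cross term is nonnegative because \<open>\<lambda>\<close> is
  weakly decreasing, and \<open>\<delta>\<close> does not vanish because every positive root pairs negatively with the
  vector of indices.
\<close>
lemma mono_sq_raise_all:
  assumes part: "is_partition la"
    and S: "finite S" "S \<subseteq> {(i, j). i < j}" "S \<noteq> {}"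
    and nonneg: "\<And>i. Poly_Mapping.lookup (raise_all S la) i \<ge> 0"
  shows "mono_sq (mono_of la) < mono_sq (mono_of (raise_all S la))"
proof -
  obtain I where I: "finite I" "Poly_Mapping.keys la \<subseteq> I"
    "Poly_Mapping.keys (raise_all S la) \<subseteq> I" "S \<subseteq> I \<times> I"
    using finite_raise_index_set[OF S(1), of la] by blast
  define l where "l = Poly_Mapping.lookup la"
  define d :: "nat \<Rightarrow> int" where "d n = (\<Sum>(i, j)\<in>S. of_bool (i = n) - of_bool (j = n))" for n
  have pairing: "(\<Sum>n\<in>I. f n * d n) = (\<Sum>(i, j)\<in>S. f i - f j)" for f :: "nat \<Rightarrow> int"
    unfolding d_def by (rule sum_weight_roots[OF I(1,4)])
  have "(\<Sum>(i, j)\<in>S. l i - l j) \<ge> 0"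
  proof (rule sum_nonneg)
    fix x assume "x \<in> S"
    then have "fst x \<le> snd x" using S(2) by auto
    then show "0 \<le> (case x of (i, j) \<Rightarrow> l i - l j)"
      using partition_antimono[OF part] by (simp add: l_def case_prod_beta)
  qed
  then have cross: "(\<Sum>n\<in>I. l n * d n) \<ge> 0" by (simp add: pairing)
  have "(\<Sum>n\<in>I. int n * d n) < 0"
  proof -
    have "(\<Sum>x\<in>S. int (fst x) - int (snd x)) < (\<Sum>x\<in>S. 0)"
      using S by (intro sum_strict_mono) auto
    then show ?thesis by (simp add: pairing case_prod_beta)
  qed
  then obtain n where n: "n \<in> I" "d n \<noteq> 0"
    by (metis (no_types, lifting) less_irrefl mult_zero_right sum.neutral)
  have "(d n)\<^sup>2 \<le> (\<Sum>n\<in>I. (d n)\<^sup>2)"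
    using n(1) I(1) by (intro member_le_sum) auto
  moreover have "(d n)\<^sup>2 > 0" using n(2) by simp
  ultimately have pos: "(\<Sum>n\<in>I. (d n)\<^sup>2) > 0" by linarith
  have "int (mono_sq (mono_of (raise_all S la))) = (\<Sum>n\<in>I. (l n + d n)\<^sup>2)"
    by (simp add: mono_sq_mono_of[OF nonneg I(1,3)] lookup_raise_all[OF S(1)] l_def d_def)
  also have "\<dots> = (\<Sum>n\<in>I. (l n)\<^sup>2) + 2 * (\<Sum>n\<in>I. l n * d n) + (\<Sum>n\<in>I. (d n)\<^sup>2)"
    by (simp add: power2_sum sum.distrib sum_distrib_left algebra_simps)
  also have "(\<Sum>n\<in>I. (l n)\<^sup>2) = int (mono_sq (mono_of la))"
    by (simp add: mono_sq_mono_of[OF lookup_partition_nonneg[OF part] I(1,2)] l_def)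
  finally show ?thesis using cross pos by linarith
qed

text \<open>
  The empty set of raising operators contributes \<open>u\<^sub>\<lambda>\<close>; every other summand is either zero or
  \<open>\<plusminus>\<close> a monomial obtained by proper raising.
\<close>
lemma schur_unitriangular:
  assumes part: "is_partition la"
    and m: "m \<in> Poly_Mapping.keys (schur la - frag_of (mono_of la))"
  shows "int (mono_deg m) = vec_sum la" and "mono_sq (mono_of la) < mono_sq m"
proof -
  define T where "T = {S. finite S \<and> S \<subseteq> {(i, j). i < j} \<and> u_vec (raise_all S la) \<noteq> 0}"
  have fin: "finite T" unfolding T_def by (rule finite_schur_support)
  have lead: "u_vec la = frag_of (mono_of la)"
    by (rule u_vec_eq_mono[OF lookup_partition_nonneg[OF part]])
  have "schur la = (\<Sum>S\<in>T. if finite S \<and> S \<subseteq> {(i, j). i < j}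
      then (- 1) ^ card S * u_vec (raise_all S la) else 0)"
    unfolding schur_def
    by (rule Sum_any.expand_superset[OF fin]) (auto simp: T_def)
  also have "\<dots> = (\<Sum>S\<in>T. (- 1) ^ card S * u_vec (raise_all S la))"
    by (rule sum.cong) (auto simp: T_def)
  also have "\<dots> = frag_of (mono_of la) + (\<Sum>S\<in>T - {{}}. (- 1) ^ card S * u_vec (raise_all S la))"
    by (subst sum.remove[OF fin, of "{}"]) (auto simp: T_def raise_all_empty lead)
  finally have "m \<in> Poly_Mapping.keys (\<Sum>S\<in>T - {{}}. (- 1) ^ card S * u_vec (raise_all S la))"
    using m by simp
  then obtain S where S: "S \<in> T" "S \<noteq> {}"
      and mS: "m \<in> Poly_Mapping.keys ((- 1) ^ card S * u_vec (raise_all S la))"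
    using keys_sum[of "\<lambda>S. (- 1) ^ card S * u_vec (raise_all S la)" "T - {{}}"] by blast
  have nonneg: "Poly_Mapping.lookup (raise_all S la) i \<ge> 0" for i
    using S(1) u_vec_eq_0[of "raise_all S la" i] by (force simp: T_def)
  have "(- 1) ^ card S = (1 :: A) \<or> (- 1) ^ card S = (- 1 :: A)"
    by (cases "even (card S)") simp_all
  then have "m \<in> Poly_Mapping.keys (u_vec (raise_all S la))"
    using mS by (auto simp: keys_minus)
  then have mono: "m = mono_of (raise_all S la)"
    by (simp add: u_vec_eq_mono[OF nonneg])
  have fS: "finite S" "S \<subseteq> {(i, j). i < j}" using S(1) by (auto simp: T_def)
  show "int (mono_deg m) = vec_sum la"
    by (simp add: mono mono_deg_mono_of[OF nonneg] vec_sum_raise_all[OF fS(1)])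
  show "mono_sq (mono_of la) < mono_sq m"
    unfolding mono by (rule mono_sq_raise_all[OF part fS S(2) nonneg])
qed

lemma schur_lead_coeff:
  assumes "is_partition la"
  shows "Poly_Mapping.lookup (schur la) (mono_of la) = 1"
proof -
  have "mono_of la \<notin> Poly_Mapping.keys (schur la - frag_of (mono_of la))"
    using schur_unitriangular(2)[OF assms] by blast
  then show ?thesis by (simp add: in_keys_iff lookup_minus)
qed

lemma schur_coeff_nonzero:
  assumes "is_partition la" "Poly_Mapping.lookup (schur la) m \<noteq> 0"
  shows "m = mono_of la \<or> mono_sq (mono_of la) < mono_sq m"
proof (cases "m = mono_of la")
  case False
  then have "m \<in> Poly_Mapping.keys (schur la - frag_of (mono_of la))"
    using assms(2) by (simp add: in_keys_iff lookup_minus)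
  then show ?thesis using schur_unitriangular(2)[OF assms(1)] by blast
qed simp

lemma schur_homogeneous:
  assumes "is_partition la" "m \<in> Poly_Mapping.keys (schur la)"
  shows "int (mono_deg m) = vec_sum la"
proof (cases "m = mono_of la")
  case True
  then show ?thesis by (simp add: mono_deg_mono_of lookup_partition_nonneg[OF assms(1)])
next
  case False
  then have "m \<in> Poly_Mapping.keys (schur la - frag_of (mono_of la))"
    using assms(2) by (simp add: in_keys_iff lookup_minus)
  then show ?thesis by (rule schur_unitriangular(1)[OF assms(1)])
qed


section \<open>The Schur polynomials as a basis\<close>

lemma of_int_mult_eq_cmul: "of_int c * p = frag_cmul c p" for p :: A
proof (induction p rule: frag_induction[OF subset_UNIV])
  case 1
  show ?case by simp
next
  case (2 m)
  have "of_int c * frag_of m = Poly_Mapping.single m c"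
    by (simp add: mult_single flip: single_of_int)
  also have "\<dots> = frag_cmul c (frag_of m)"
    by (rule poly_mapping_eqI) (simp add: lookup_single when_def)
  finally show ?case .
next
  case (3 a b)
  have "frag_cmul c (a - b) = frag_cmul c a - frag_cmul c b"
    by (rule poly_mapping_eqI) (simp add: lookup_minus algebra_simps)
  then show ?case using 3 by (simp add: right_diff_distrib)
qed

lemma frag_extend_superset:
  assumes "finite P" "Poly_Mapping.keys k \<subseteq> P"
  shows "frag_extend f k = (\<Sum>i\<in>P. frag_cmul (Poly_Mapping.lookup k i) (f i))"
  unfolding frag_extend_def using assms
  by (intro sum.mono_neutral_left) (auto simp: in_keys_iff)

text \<open>
  Subtract from \<open>m = u\<^sub>\<lambda>\<close> its Schur polynomial \<open>U\<^sub>\<lambda>\<close>: what is left involves only monomials of the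
  same degree and larger square sum, so the process ends.
\<close>
lemma schur_span:
  assumes "mono_deg m = n"
  shows "\<exists>k. Poly_Mapping.keys k \<subseteq> partitions_of n \<and> frag_extend schur k = frag_of m"
  using assms
proof (induction "n\<^sup>2 - mono_sq m" arbitrary: m rule: less_induct)
  case less
  define Q where "Q p \<longleftrightarrow> (\<exists>k. Poly_Mapping.keys k \<subseteq> partitions_of n \<and> frag_extend schur k = p)" for p
  obtain la where la: "is_partition la" "mono_of la = m" using mono_of_surj by blast
  then have sum: "vec_sum la = int n"
    using mono_deg_mono_of[of la] lookup_partition_nonneg less.prems by metis
  have diff: "Q (p - q)" if p: "Q p" and q: "Q q" for p q
  proof -
    obtain k l where k: "Poly_Mapping.keys k \<subseteq> partitions_of n" "frag_extend schur k = p"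
      and l: "Poly_Mapping.keys l \<subseteq> partitions_of n" "frag_extend schur l = q"
      using p q unfolding Q_def by blast
    have "Poly_Mapping.keys (k - l) \<subseteq> partitions_of n"
      using keys_diff[of k l] k(1) l(1) by blast
    moreover have "frag_extend schur (k - l) = p - q"
      by (simp add: frag_extend_diff k(2) l(2))
    ultimately show ?thesis unfolding Q_def by blast
  qed
  have higher: "Q (frag_of x)" if "mono_deg x = n" "mono_sq m < mono_sq x" for x
    unfolding Q_def
  proof (rule less.hyps)
    show "n\<^sup>2 - mono_sq x < n\<^sup>2 - mono_sq m"
      using that(2) mono_sq_le[of x] unfolding that(1) by linarith
  qed (rule that(1))
  have "Q (schur la - frag_of m)"
  proof (rule frag_induction[of _ "{x. mono_deg x = n \<and> mono_sq m < mono_sq x}"])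
    show "Poly_Mapping.keys (schur la - frag_of m) \<subseteq> {x. mono_deg x = n \<and> mono_sq m < mono_sq x}"
      using schur_unitriangular[OF la(1)] unfolding la(2) sum by auto
    show "Q 0" unfolding Q_def by (intro exI[of _ 0]) simp
  qed (use higher diff in auto)
  moreover have "Q (schur la)"
    unfolding Q_def using la(1) sum by (intro exI[of _ "frag_of la"]) (simp add: partitions_of_def)
  ultimately have "Q (schur la - (schur la - frag_of m))" by (rule diff[rotated])
  then have "Q (frag_of m)" by (simp only: diff_diff_eq2 add_diff_cancel_left')
  then show ?case by (simp only: Q_def)
qed

text \<open>
  In a linear relation, take a partition \<open>\<lambda>\<close> of least square sum: no other participating Schur
  polynomial contains the monomial \<open>u\<^sub>\<lambda>\<close>, so the coefficient of \<open>U\<^sub>\<lambda>\<close> vanishes.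
\<close>
lemma schur_independent:
  assumes keys: "Poly_Mapping.keys k \<subseteq> Collect is_partition"
    and zero: "frag_extend schur k = 0"
  shows "k = 0"
proof (rule ccontr)
  assume "k \<noteq> 0"
  then have ne: "Poly_Mapping.keys k \<noteq> {}" by simp
  define la where "la = arg_min_on (\<lambda>nu. mono_sq (mono_of nu)) (Poly_Mapping.keys k)"
  have la: "la \<in> Poly_Mapping.keys k"
    unfolding la_def by (rule arg_min_if_finite(1)[OF finite_keys ne])
  have min: "mono_sq (mono_of la) \<le> mono_sq (mono_of nu)" if "nu \<in> Poly_Mapping.keys k" for nu
    unfolding la_def by (rule arg_min_least[OF finite_keys ne that])
  have part: "is_partition nu" if "nu \<in> Poly_Mapping.keys k" for nu
    using keys that by blast
  have "Poly_Mapping.lookup (schur nu) (mono_of la) = of_bool (nu = la)"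
    if nu: "nu \<in> Poly_Mapping.keys k" for nu
  proof (cases "nu = la")
    case True
    then show ?thesis using schur_lead_coeff[OF part[OF la]] by simp
  next
    case False
    then have "mono_of la \<noteq> mono_of nu" using mono_of_inj[OF part[OF la] part[OF nu]] by blast
    then show ?thesis
      using schur_coeff_nonzero[OF part[OF nu], of "mono_of la"] min[OF nu] False by auto
  qed
  then have "Poly_Mapping.lookup (frag_extend schur k) (mono_of la) =
      (\<Sum>nu\<in>Poly_Mapping.keys k. Poly_Mapping.lookup k nu * of_bool (nu = la))"
    unfolding frag_extend_def lookup_sum by simp
  also have "\<dots> = Poly_Mapping.lookup k la"
    using la by simp
  finally show False using zero la by (simp add: in_keys_iff)
qed

lemma schur_coeffs_unique:
  assumes "finite P" "P \<subseteq> Collect is_partition"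
    and eq: "(\<Sum>la\<in>P. of_int (a la) * schur la) = (\<Sum>la\<in>P. of_int (b la) * schur la)"
    and "la \<in> P"
  shows "a la = b la"
proof -
  define k where "k = (\<Sum>la\<in>P. frag_cmul (a la - b la) (frag_of la))"
  have k: "Poly_Mapping.lookup k nu = (if nu \<in> P then a nu - b nu else 0)" for nu
    unfolding k_def lookup_sum using assms(1) by (auto simp: if_distrib cong: if_cong)
  have "frag_extend schur k = (\<Sum>la\<in>P. of_int (a la - b la) * schur la)"
    unfolding k_def by (simp add: frag_extend_sum assms(1) frag_extend_cmul of_int_mult_eq_cmul
        del: of_int_diff)
  also have "\<dots> = 0" using eq by (simp add: left_diff_distrib sum_subtractf)
  finally have "k = 0"
    by (intro schur_independent) (use assms(2) in \<open>auto simp: in_keys_iff k split: if_splits\<close>)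
  then show ?thesis using k[of la] assms(4) by simp
qed


section \<open>Kostka numbers and their inverse\<close>

lemma partitions_of_partition: "partitions_of n \<subseteq> Collect is_partition"
  by (auto simp: partitions_of_def)

lemma partition_in_partitions_of:
  assumes "is_partition la"
  obtains n where "la \<in> partitions_of n"
proof -
  have "vec_sum la \<ge> 0"
    unfolding vec_sum_def by (intro sum_nonneg lookup_partition_nonneg[OF assms])
  then show ?thesis using that[of "nat (vec_sum la)"] assms by (simp add: partitions_of_def)
qed

lemma u_vec_partition: "mu \<in> partitions_of n \<Longrightarrow> u_vec mu = frag_of (mono_of mu)"
  by (intro u_vec_eq_mono lookup_partition_nonneg) (simp add: partitions_of_def)

text \<open>
  Existence comes from \<open>schur_span\<close> and uniqueness from \<open>schur_independent\<close>. The support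
  condition follows because the expansion can be found within the degree of \<open>\<mu>\<close>.
\<close>
lemma kostka_expansion:
  assumes mu: "mu \<in> partitions_of n"
  shows "u_vec mu = (\<Sum>la\<in>partitions_of n. of_int (kostka la mu) * schur la)"
    and "kostka la mu \<noteq> 0 \<Longrightarrow> la \<in> partitions_of n"
proof -
  have "int (mono_deg (mono_of mu)) = int n"
    using mu by (subst mono_deg_mono_of) (auto simp: partitions_of_def lookup_partition_nonneg)
  then obtain k where k: "Poly_Mapping.keys k \<subseteq> partitions_of n"
      "frag_extend schur k = u_vec mu"
    using schur_span[of "mono_of mu" n] u_vec_partition[OF mu] by auto
  have kostka: "kostka la mu = Poly_Mapping.lookup k la" for la
  proof -
    have "(THE k. Poly_Mapping.keys k \<subseteq> Collect is_partition \<and>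
        u_vec mu = (\<Sum>\<nu>\<in>Poly_Mapping.keys k. of_int (Poly_Mapping.lookup k \<nu>) * schur \<nu>)) = k"
    proof (rule the_equality)
      show "Poly_Mapping.keys k \<subseteq> Collect is_partition \<and>
          u_vec mu = (\<Sum>\<nu>\<in>Poly_Mapping.keys k. of_int (Poly_Mapping.lookup k \<nu>) * schur \<nu>)"
        using k partitions_of_partition[of n] by (auto simp: frag_extend_def of_int_mult_eq_cmul)
    next
      fix l :: "int_vec \<Rightarrow>\<^sub>0 int"
      assume l: "Poly_Mapping.keys l \<subseteq> Collect is_partition \<and>
          u_vec mu = (\<Sum>\<nu>\<in>Poly_Mapping.keys l. of_int (Poly_Mapping.lookup l \<nu>) * schur \<nu>)"
      have "l - k = 0"
      proof (rule schur_independent)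
        show "Poly_Mapping.keys (l - k) \<subseteq> Collect is_partition"
          using keys_diff[of l k] l k(1) partitions_of_partition[of n] by blast
        have "frag_extend schur l = u_vec mu"
          using l by (simp add: frag_extend_def of_int_mult_eq_cmul)
        then show "frag_extend schur (l - k) = 0" by (simp add: frag_extend_diff k(2))
      qed
      then show "l = k" by simp
    qed
    then show ?thesis unfolding kostka_def by simp
  qed
  show "u_vec mu = (\<Sum>la\<in>partitions_of n. of_int (kostka la mu) * schur la)"
    unfolding k(2)[symmetric] frag_extend_superset[OF finite_partitions_of k(1)]
    by (simp add: kostka of_int_mult_eq_cmul)
  show "kostka la mu \<noteq> 0 \<Longrightarrow> la \<in> partitions_of n"
    using k(1) by (auto simp: kostka in_keys_iff)
qed

text \<open>
  The entries of the inverse Kostka matrix.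
\<close>
definition schur_coeff :: "int_vec \<Rightarrow> int_vec \<Rightarrow> int" where
  "schur_coeff mu la = Poly_Mapping.lookup (schur la) (mono_of mu)"

lemma schur_expansion:
  assumes la: "la \<in> partitions_of n"
  shows "schur la = (\<Sum>mu\<in>partitions_of n. of_int (schur_coeff mu la) * u_vec mu)"
proof -
  have part: "is_partition la" and sum: "vec_sum la = int n"
    using la by (auto simp: partitions_of_def)
  have "Poly_Mapping.keys (schur la) \<subseteq> mono_of ` partitions_of n"
  proof
    fix m assume m: "m \<in> Poly_Mapping.keys (schur la)"
    obtain mu where mu: "is_partition mu" "mono_of mu = m" using mono_of_surj by blast
    have "vec_sum mu = int n"
      using mono_deg_mono_of[of mu] lookup_partition_nonneg[OF mu(1)] mu(2)
        schur_homogeneous[OF part m] sum by simp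
    then show "m \<in> mono_of ` partitions_of n"
      using mu by (force simp: partitions_of_def)
  qed
  then have "schur la = (\<Sum>m\<in>mono_of ` partitions_of n.
      frag_cmul (Poly_Mapping.lookup (schur la) m) (frag_of m))"
    by (subst frag_expansion, intro frag_extend_superset finite_imageI finite_partitions_of)
  also have "\<dots> = (\<Sum>mu\<in>partitions_of n. frag_cmul (schur_coeff mu la) (frag_of (mono_of mu)))"
    unfolding schur_coeff_def
    by (subst sum.reindex) (auto intro!: inj_onI mono_of_inj simp: partitions_of_def)
  also have "\<dots> = (\<Sum>mu\<in>partitions_of n. of_int (schur_coeff mu la) * u_vec mu)"
    by (intro sum.cong) (simp_all add: of_int_mult_eq_cmul u_vec_partition)
  finally show ?thesis .
qed

lemma sum_of_int_mult_swap:
  fixes f :: "'i \<Rightarrow> A"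
  shows "(\<Sum>j\<in>J. of_int (a j) * (\<Sum>i\<in>I. of_int (b i j) * f i)) =
    (\<Sum>i\<in>I. of_int (\<Sum>j\<in>J. b i j * a j) * f i)"
  by (simp add: sum_distrib_left sum_distrib_right mult_ac) (rule sum.swap)

text \<open>
  Expand \<open>U\<close> into the \<open>u\<close> and back, and compare coefficients in the basis of the \<open>U\<close>. The other
  product of the two matrices is treated likewise in the basis of monomials.
\<close>
lemma kostka_schur_coeff:
  assumes ka: "ka \<in> partitions_of n" and la: "la \<in> partitions_of n"
  shows "(\<Sum>mu\<in>partitions_of n. kostka la mu * schur_coeff mu ka) = of_bool (la = ka)"
proof (rule schur_coeffs_unique[OF finite_partitions_of partitions_of_partition _ la])
  have "(\<Sum>la\<in>partitions_of n. of_int (\<Sum>mu\<in>partitions_of n. kostka la mu * schur_coeff mu ka) * schur la)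
      = (\<Sum>mu\<in>partitions_of n. of_int (schur_coeff mu ka) * u_vec mu)"
    unfolding sum_of_int_mult_swap[symmetric] by (simp add: kostka_expansion(1)[symmetric])
  also have "\<dots> = schur ka" by (rule schur_expansion[OF ka, symmetric])
  also have "\<dots> = (\<Sum>la\<in>partitions_of n. of_int (of_bool (la = ka)) * schur la)"
    using ka by (simp add: finite_partitions_of)
  finally show "(\<Sum>la\<in>partitions_of n. of_int (\<Sum>mu\<in>partitions_of n. kostka la mu * schur_coeff mu ka) * schur la)
      = (\<Sum>la\<in>partitions_of n. of_int (of_bool (la = ka)) * schur la)" .
qed

lemma schur_coeff_kostka:
  assumes mu: "mu \<in> partitions_of n" and nu: "nu \<in> partitions_of n"
  shows "(\<Sum>la\<in>partitions_of n. schur_coeff nu la * kostka la mu) = of_bool (nu = mu)"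
proof -
  have coeff: "Poly_Mapping.lookup (u_vec ka) (mono_of nu) = of_bool (ka = nu)"
    if ka: "ka \<in> partitions_of n" for ka
    using mono_of_inj[of nu ka] nu ka
    by (auto simp: u_vec_partition partitions_of_def)
  have "Poly_Mapping.lookup (u_vec mu) (mono_of nu) =
      (\<Sum>la\<in>partitions_of n. kostka la mu * schur_coeff nu la)"
    by (subst kostka_expansion(1)[OF mu])
      (simp add: lookup_sum of_int_mult_eq_cmul schur_coeff_def)
  then show ?thesis by (simp add: coeff[OF mu] mult.commute eq_commute)
qed

text \<open>
  Inverting \<open>U\<^sub>\<lambda> = \<Sum>\<^sub>\<mu> K\<^sub>\<lambda>\<^sub>\<mu> t\<^sub>\<mu>\<close> gives the only candidate for \<open>t\<close>. That it solves the equations is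
  \<open>kostka_schur_coeff\<close>; that it is the only solution is \<open>schur_coeff_kostka\<close>.
\<close>
lemma t_poly_expansions:
  shows "la \<in> partitions_of n \<Longrightarrow>
      schur la = (\<Sum>mu\<in>partitions_of n. of_int (kostka la mu) * t_poly mu)"
    and "nu \<in> partitions_of n \<Longrightarrow>
      t_poly nu = (\<Sum>la\<in>partitions_of n. of_int (schur_coeff nu la) * schur la)"
proof -
  have sum_eq: "(\<Sum>\<mu> | is_partition \<mu> \<and> kostka la \<mu> \<noteq> 0. of_int (kostka la \<mu>) * t \<mu>) =
      (\<Sum>mu\<in>partitions_of n. of_int (kostka la mu) * t mu)"
    if la: "la \<in> partitions_of n" for la n and t :: "int_vec \<Rightarrow> A"
  proof (rule sum.mono_neutral_left)
    \<comment> \<open>The index set is finite because a Kostka number vanishes unless both sizes agree.\<close>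
    show "{\<mu>. is_partition \<mu> \<and> kostka la \<mu> \<noteq> 0} \<subseteq> partitions_of n"
    proof clarify
      fix mu assume mu: "is_partition mu" "kostka la mu \<noteq> 0"
      obtain m where m: "mu \<in> partitions_of m" using partition_in_partitions_of[OF mu(1)] .
      have "la \<in> partitions_of m" by (rule kostka_expansion(2)[OF m mu(2)])
      then show "mu \<in> partitions_of n" using la m by (auto simp: partitions_of_def)
    qed
    show "\<forall>mu\<in>partitions_of n - {\<mu>. is_partition \<mu> \<and> kostka la \<mu> \<noteq> 0}. of_int (kostka la mu) * t mu = 0"
      by (auto simp: partitions_of_def)
  qed (rule finite_partitions_of)
  define s where "s nu = (if is_partition nu then
      \<Sum>la\<in>partitions_of (nat (vec_sum nu)). of_int (schur_coeff nu la) * schur la else 0)" for nu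
  have s: "s nu = (\<Sum>la\<in>partitions_of n. of_int (schur_coeff nu la) * schur la)"
    if "nu \<in> partitions_of n" for nu n
    using that by (simp add: s_def partitions_of_def)
  have schur_s: "schur la = (\<Sum>mu\<in>partitions_of n. of_int (kostka la mu) * s mu)"
    if la: "la \<in> partitions_of n" for la n
  proof -
    have "(\<Sum>mu\<in>partitions_of n. of_int (kostka la mu) * s mu) =
        (\<Sum>ka\<in>partitions_of n. of_int (\<Sum>mu\<in>partitions_of n. schur_coeff mu ka * kostka la mu) * schur ka)"
      by (simp only: s sum_of_int_mult_swap cong: sum.cong)
    also have "\<dots> = (\<Sum>ka\<in>partitions_of n. of_bool (la = ka) * schur ka)"
      using kostka_schur_coeff[OF _ la] by (intro sum.cong) (simp_all add: mult.commute)
    also have "\<dots> = schur la" using la by (simp add: finite_partitions_of)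
    finally show ?thesis ..
  qed
  have "t_poly = s"
    unfolding t_poly_def
  proof (rule the_equality)
    show "(\<forall>la. is_partition la \<longrightarrow>
        schur la = (\<Sum>\<mu> | is_partition \<mu> \<and> kostka la \<mu> \<noteq> 0. of_int (kostka la \<mu>) * s \<mu>)) \<and>
        (\<forall>\<alpha>. \<not> is_partition \<alpha> \<longrightarrow> s \<alpha> = 0)"
    proof (intro conjI allI impI)
      fix la assume "is_partition la"
      then obtain n where "la \<in> partitions_of n" by (rule partition_in_partitions_of)
      then show "schur la = (\<Sum>\<mu> | is_partition \<mu> \<and> kostka la \<mu> \<noteq> 0. of_int (kostka la \<mu>) * s \<mu>)"
        by (simp only: sum_eq schur_s[symmetric])
    qed (simp add: s_def)
  next
    fix t :: "int_vec \<Rightarrow> A"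
    assume t: "(\<forall>la. is_partition la \<longrightarrow>
        schur la = (\<Sum>\<mu> | is_partition \<mu> \<and> kostka la \<mu> \<noteq> 0. of_int (kostka la \<mu>) * t \<mu>)) \<and>
        (\<forall>\<alpha>. \<not> is_partition \<alpha> \<longrightarrow> t \<alpha> = 0)"
    show "t = s"
    proof
      fix nu
      show "t nu = s nu"
      proof (cases "is_partition nu")
        case True
        then obtain n where nu: "nu \<in> partitions_of n" by (rule partition_in_partitions_of)
        have schur_t: "schur la = (\<Sum>mu\<in>partitions_of n. of_int (kostka la mu) * t mu)"
          if "la \<in> partitions_of n" for la
          using t that sum_eq[OF that, of t] by (auto simp: partitions_of_def)
        have "s nu = (\<Sum>la\<in>partitions_of n. of_int (schur_coeff nu la) *
            (\<Sum>mu\<in>partitions_of n. of_int (kostka la mu) * t mu))"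
          unfolding s[OF nu] by (intro sum.cong) (simp_all flip: schur_t)
        also have "\<dots> = (\<Sum>mu\<in>partitions_of n.
            of_int (\<Sum>la\<in>partitions_of n. kostka la mu * schur_coeff nu la) * t mu)"
          by (rule sum_of_int_mult_swap)
        also have "\<dots> = (\<Sum>mu\<in>partitions_of n. of_bool (nu = mu) * t mu)"
          using schur_coeff_kostka[OF _ nu] by (intro sum.cong) (simp_all add: mult.commute)
        also have "\<dots> = t nu" using nu by (simp add: finite_partitions_of)
        finally show ?thesis ..
      qed (use t in \<open>simp add: s_def\<close>)
    qed
  qed
  note t_eq = this
  show "schur la = (\<Sum>mu\<in>partitions_of n. of_int (kostka la mu) * t_poly mu)"
    if "la \<in> partitions_of n"
    unfolding t_eq by (rule schur_s[OF that])
  show "t_poly nu = (\<Sum>la\<in>partitions_of n. of_int (schur_coeff nu la) * schur la)"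
    if "nu \<in> partitions_of n"
    unfolding t_eq by (rule s[OF that])
qed


section \<open>The identity in each degree\<close>

lemma tens_zero_left: "0 \<otimes>\<^sub>Z b = 0"
  using tens_add_left[of 0 0 b] by simp

lemma tens_zero_right: "a \<otimes>\<^sub>Z 0 = 0"
  using tens_add_right[of a 0 0] by simp

lemma tens_diff_left: "(a - a') \<otimes>\<^sub>Z b = a \<otimes>\<^sub>Z b - a' \<otimes>\<^sub>Z b"
  using tens_add_left[of "a - a'" a' b] by (simp add: eq_diff_eq)

lemma tens_diff_right: "a \<otimes>\<^sub>Z (b - b') = a \<otimes>\<^sub>Z b - a \<otimes>\<^sub>Z b'"
  using tens_add_right[of a "b - b'" b'] by (simp add: eq_diff_eq)

lemma tens_sum_left: "(\<Sum>i\<in>I. f i) \<otimes>\<^sub>Z b = (\<Sum>i\<in>I. f i \<otimes>\<^sub>Z b)"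
  by (induction I rule: infinite_finite_induct) (simp_all add: tens_zero_left tens_add_left)

lemma tens_sum_right: "a \<otimes>\<^sub>Z (\<Sum>i\<in>I. f i) = (\<Sum>i\<in>I. a \<otimes>\<^sub>Z f i)"
  by (induction I rule: infinite_finite_induct) (simp_all add: tens_zero_right tens_add_right)

lemma tens_of_int:
  fixes a :: "'a::ring_1" and b :: "'b::ring_1"
  shows "(of_int k * a) \<otimes>\<^sub>Z b = a \<otimes>\<^sub>Z (of_int k * b)"
proof -
  have nat: "(of_nat n * a) \<otimes>\<^sub>Z b = a \<otimes>\<^sub>Z (of_nat n * b)" for n
    by (induction n)
      (simp_all add: tens_zero_left tens_zero_right tens_add_left tens_add_right distrib_right)
  obtain m n where "k = int m - int n" by (rule int_diff_cases)
  then show ?thesis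
    by (simp add: left_diff_distrib tens_diff_left tens_diff_right nat)
qed

lemma omega_sum: "omega (\<Sum>i\<in>I. f i) = (\<Sum>i\<in>I. omega (f i))"
  by (induction I rule: infinite_finite_induct) (simp_all add: omega_zero omega_add)

lemma omega_prod: "omega (\<Prod>i\<in>I. f i) = (\<Prod>i\<in>I. omega (f i))"
  by (induction I rule: infinite_finite_induct) (simp_all add: omega_one omega_mult)

lemma omega_of_int: "omega (of_int k) = of_int k"
  unfolding single_of_int[symmetric] omega_single by (simp add: omega_mono_def)

lemma omega_u_vec: "omega (u_vec \<alpha>) = v_vec \<alpha>"
  by (simp add: u_vec_def v_vec_def omega_prod omega_u)

text \<open>
  Expanding \<open>U\<^sub>\<lambda>\<close> into the \<open>t\<^sub>\<mu>\<close> on the left transposes the Kostka matrix on the right, where it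
  assembles the \<open>V\<^sub>\<lambda>\<close> into \<open>\<omega>(u\<^sub>\<mu>) = v\<^sub>\<mu>\<close>.
\<close>
lemma dual_cauchy_degree:
  "(\<Sum>la\<in>partitions_of n. schur la \<otimes>\<^sub>Z V la) = (\<Sum>la\<in>partitions_of n. t_poly la \<otimes>\<^sub>Z v_vec la)"
proof -
  let ?P = "partitions_of n"
  have "(\<Sum>la\<in>?P. schur la \<otimes>\<^sub>Z V la) =
      (\<Sum>la\<in>?P. \<Sum>mu\<in>?P. t_poly mu \<otimes>\<^sub>Z (of_int (kostka la mu) * V la))"
  proof (rule sum.cong)
    fix la assume "la \<in> ?P"
    then have "schur la = (\<Sum>mu\<in>?P. of_int (kostka la mu) * t_poly mu)"
      by (rule t_poly_expansions(1))
    then show "schur la \<otimes>\<^sub>Z V la = (\<Sum>mu\<in>?P. t_poly mu \<otimes>\<^sub>Z (of_int (kostka la mu) * V la))"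
      by (simp only: tens_sum_left tens_of_int)
  qed simp
  also have "\<dots> = (\<Sum>mu\<in>?P. t_poly mu \<otimes>\<^sub>Z (\<Sum>la\<in>?P. of_int (kostka la mu) * V la))"
    unfolding tens_sum_right by (rule sum.swap)
  also have "\<dots> = (\<Sum>mu\<in>?P. t_poly mu \<otimes>\<^sub>Z v_vec mu)"
  proof (rule sum.cong)
    fix mu assume "mu \<in> ?P"
    then have "v_vec mu = omega (\<Sum>la\<in>?P. of_int (kostka la mu) * schur la)"
      by (simp only: kostka_expansion(1)[symmetric] omega_u_vec)
    also have "\<dots> = (\<Sum>la\<in>?P. of_int (kostka la mu) * V la)"
      by (simp add: omega_sum omega_mult omega_of_int V_def)
    finally show "t_poly mu \<otimes>\<^sub>Z (\<Sum>la\<in>?P. of_int (kostka la mu) * V la) = t_poly mu \<otimes>\<^sub>Z v_vec mu"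
      by simp
  qed simp
  finally show ?thesis .
qed


section \<open>Formal sums over all partitions\<close>

lemma hom_part_zero: "hom_part d 0 = 0"
  by (simp add: hom_part_def)

lemma hom_part_schur:
  assumes "la \<in> partitions_of n" "d \<noteq> n"
  shows "hom_part d (schur la) = 0"
  unfolding hom_part_def
proof (rule frag_extend_eq_0)
  fix m assume "m \<in> Poly_Mapping.keys (schur la)"
  then have "int (mono_deg m) = int n"
    using assms(1) schur_homogeneous by (fastforce simp: partitions_of_def)
  then show "(if mono_deg m = d then frag_of m else 0) = 0" using assms(2) by simp
qed

lemma hom_part_t_poly:
  assumes "la \<in> partitions_of n" "d \<noteq> n"
  shows "hom_part d (t_poly la) = 0"
proof -
  have sum: "hom_part d (\<Sum>i\<in>I. f i) = (\<Sum>i\<in>I. hom_part d (f i))" for f :: "int_vec \<Rightarrow> A" and I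
    by (induction I rule: infinite_finite_induct) (simp_all add: hom_part_add hom_part_zero)
  have cmul: "hom_part d (of_int k * p) = of_int k * hom_part d p" for k p
    by (simp add: of_int_mult_eq_cmul hom_part_def frag_extend_cmul)
  show ?thesis
    unfolding t_poly_expansions(2)[OF assms(1)]
    by (simp add: sum cmul hom_part_schur assms(2))
qed

lemma bihom_part_add: "bihom_part d e (x + y) = bihom_part d e x + bihom_part d e y"
  by transfer (simp add: tensor_rel_def frag_extend_add biadd_rels.zero)

lemma bihom_part_zero: "bihom_part d e 0 = 0"
  using bihom_part_add[of d e 0 0] by simp

lemma bihom_part_sum: "bihom_part d e (\<Sum>i\<in>I. f i) = (\<Sum>i\<in>I. bihom_part d e (f i))"
  by (induction I rule: infinite_finite_induct) (simp_all add: bihom_part_zero bihom_part_add)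

text \<open>
  Homogeneity in the first tensor factor alone confines the component of bidegree \<open>(d, e)\<close> to the
  finitely many partitions of \<open>d\<close>.
\<close>
lemma graded_formal_sum:
  assumes graded: "\<And>la n d e. la \<in> partitions_of n \<Longrightarrow> d \<noteq> n \<Longrightarrow> bihom_part d e (F la) = 0"
  shows "formally_summable F {la. is_partition la}"
    and "formal_sum F {la. is_partition la} d e = bihom_part d e (\<Sum>la\<in>partitions_of d. F la)"
proof -
  have sub: "{la \<in> {la. is_partition la}. bihom_part d e (F la) \<noteq> 0} \<subseteq> partitions_of d" for d e
  proof clarify
    fix la assume la: "is_partition la" "bihom_part d e (F la) \<noteq> 0"
    obtain n where "la \<in> partitions_of n" using partition_in_partitions_of[OF la(1)] .
    then show "la \<in> partitions_of d" using graded la(2) by metis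
  qed
  show "formally_summable F {la. is_partition la}"
    unfolding formally_summable_def using sub finite_partitions_of finite_subset by blast
  show "formal_sum F {la. is_partition la} d e = bihom_part d e (\<Sum>la\<in>partitions_of d. F la)"
    unfolding formal_sum_def bihom_part_sum
    by (rule sum.mono_neutral_left[OF finite_partitions_of])
      (use sub in \<open>auto simp: partitions_of_def\<close>)
qed

theorem mainTheorem5:
  shows "(\<forall>n::nat. (\<Sum>la\<in>partitions_of n. schur la \<otimes>\<^sub>Z V la) =
                   (\<Sum>la\<in>partitions_of n. t_poly la \<otimes>\<^sub>Z v_vec la)) \<and>
         (formally_summable (\<lambda>la. schur la \<otimes>\<^sub>Z V la) {la. is_partition la} \<and>
          formally_summable (\<lambda>la. t_poly la \<otimes>\<^sub>Z v_vec la) {la. is_partition la} \<and>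
          formal_sum (\<lambda>la. schur la \<otimes>\<^sub>Z V la) {la. is_partition la} =
          formal_sum (\<lambda>la. t_poly la \<otimes>\<^sub>Z v_vec la) {la. is_partition la})"
proof -
  have U: "bihom_part d e (schur la \<otimes>\<^sub>Z V la) = 0" if "la \<in> partitions_of n" "d \<noteq> n" for la n d e
    by (simp add: bihom_part_tens hom_part_schur[OF that] tens_zero_left)
  have t: "bihom_part d e (t_poly la \<otimes>\<^sub>Z v_vec la) = 0" if "la \<in> partitions_of n" "d \<noteq> n" for la n d e
    by (simp add: bihom_part_tens hom_part_t_poly[OF that] tens_zero_left)
  note Us = graded_formal_sum[of "\<lambda>la. schur la \<otimes>\<^sub>Z V la"]
  note ts = graded_formal_sum[of "\<lambda>la. t_poly la \<otimes>\<^sub>Z v_vec la"]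
  have summable: "formally_summable (\<lambda>la. schur la \<otimes>\<^sub>Z V la) {la. is_partition la}"
      "formally_summable (\<lambda>la. t_poly la \<otimes>\<^sub>Z v_vec la) {la. is_partition la}"
    using Us(1) U ts(1) t by blast+
  have "formal_sum (\<lambda>la. schur la \<otimes>\<^sub>Z V la) {la. is_partition la} d e =
      formal_sum (\<lambda>la. t_poly la \<otimes>\<^sub>Z v_vec la) {la. is_partition la} d e" for d e
  proof -
    have "formal_sum (\<lambda>la. schur la \<otimes>\<^sub>Z V la) {la. is_partition la} d e =
        bihom_part d e (\<Sum>la\<in>partitions_of d. schur la \<otimes>\<^sub>Z V la)"
      by (rule Us(2)) (rule U)
    also have "\<dots> = bihom_part d e (\<Sum>la\<in>partitions_of d. t_poly la \<otimes>\<^sub>Z v_vec la)"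
      by (simp only: dual_cauchy_degree)
    also have "\<dots> = formal_sum (\<lambda>la. t_poly la \<otimes>\<^sub>Z v_vec la) {la. is_partition la} d e"
      by (rule ts(2)[symmetric]) (rule t)
    finally show ?thesis .
  qed
  then have "formal_sum (\<lambda>la. schur la \<otimes>\<^sub>Z V la) {la. is_partition la} =
      formal_sum (\<lambda>la. t_poly la \<otimes>\<^sub>Z v_vec la) {la. is_partition la}"
    by (intro ext)
  then show ?thesis using dual_cauchy_degree summable by blast
qed

end
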